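(* Let $n\ge1$ and $N\ge1$ be integers, let $a<b$ be real numbers, and let $f:[a,b]\to\mathbb{R}$ be such that $f^{(n-1)}$ exists and is continuous on $[a,b]$. Let $c\in\mathbb{R}$ be such that $p_n+c$ has a real root in $[0,1]$. Then $$\left|E_{(a,b)}^N(p_n+c,f)\right|\le \frac{(b-a)^n}{N^{n-1}}\,\|f^{(n)}\|_{\mathcal{A}_c}\,V_{[0,1]}p_n .$$
   Context: The Bernoulli polynomials $B_n(x)$ are defined by $B_0(x)=1$ and, for $n\ge1$, $\frac{d}{dx}B_n(x)=nB_{n-1}(x)$ together with $\int_0^1 B_n(x)\,dx=0$. Put $p_n(x)=B_n(x)/n!$. $V_{[0,1]}g$ is the total variation of $g$ on $[0,1]$. Distributional Denjoy integral: if a distribution $g$ on $[\alpha,\beta]$ is the distributional derivative of a continuous function $G:[\alpha,\beta]\to\mathbb{R}$, then $\int_\alpha^\beta g=G(\beta)-G(\alpha)$, and for $w:[\alpha,\beta]\to\mathbb{R}$ of bounded variation, $\int_\alpha^\beta g\,w=G(\beta)w(\beta)-G(\alpha)w(\alpha)-\int_\alpha^\beta G\,dw$ (Riemann–Stieltjes integral). The Alexiewicz norm on $[a,b]$ is $\|g\|_{\mathcal{A}_c}=\max_{x,y\in[a,b]}|G(x)-G(y)|$. When $f^{(n-1)}$ is merely continuous, $f^{(n)}$ denotes its distributional derivative, so $\|f^{(n)}\|_{\mathcal{A}_c}=\max_{x,y\in[a,b]}|f^{(n-1)}(x)-f^{(n-1)}(y)|$. For a polynomial $p$ of degree $n$ with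 leading coefficient $1/n!$ and a subinterval $[\alpha,\beta]\subseteq[a,b]$ the error term is $$E_{(\alpha,\beta)}(p,f)=(-1)^n(\beta-\alpha)^{n+1}\int_0^1 p(x)f^{(n)}\big(\alpha+(\beta-\alpha)x\big)\,dx$$ in the distributional Denjoy sense, where $x\mapsto f^{(n)}(\alpha+(\beta-\alpha)x)$ is the distributional derivative of $x\mapsto f^{(n-1)}(\alpha+(\beta-\alpha)x)/(\beta-\alpha)$; explicitly, $$E_{(\alpha,\beta)}(p,f)=(-1)^n(\beta-\alpha)^{n}\Big[p(1)f^{(n-1)}(\beta)-p(0)f^{(n-1)}(\alpha)-\int_0^1 f^{(n-1)}\big(\alpha+(\beta-\alpha)x\big)\,p'(x)\,dx\Big].$$ With $h=(b-a)/N$, the composite error term is $E_{(a,b)}^N(p,f)=\sum_{k=0}^{N-1}E_{(a+kh,\,a+(k+1)h)}(p,f)$. *)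

theory Defs
  imports "HOL-Analysis.Analysis"
begin

section \<open>Bernoulli polynomials\<close>

primrec bernoulli_poly :: "nat \<Rightarrow> real poly" where
  "bernoulli_poly 0 = 1"
| "bernoulli_poly (Suc n) =
     (THE p. pderiv p = smult (real (Suc n)) (bernoulli_poly n) \<and> integral {0..1} (poly p) = 0)"

lemma poly_antiderivative_exists: "\<exists>q. pderiv q = (p :: real poly)"
proof -
  have "pderiv (\<Sum>i\<le>degree p. monom (coeff p i / real (Suc i)) (Suc i)) =
          (\<Sum>i\<le>degree p. monom (coeff p i) i)"
    by (simp add: higher_pderiv_sum [of 1, simplified] pderiv_monom del: of_nat_Suc)
  then show ?thesis
    by (metis poly_as_sum_of_monoms)
qed

lemma bernoulli_poly_step_unique:
  "\<exists>!q. pderiv q = (p :: real poly) \<and> integral {0..1} (poly q) = 0"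
proof -
  have int: "poly r integrable_on {0..1}" for r :: "real poly"
    by (intro integrable_continuous_interval continuous_intros)
  have shift: "integral {0..1} (poly (r + [:c:])) = integral {0..1} (poly r) + c" for r :: "real poly" and c
  proof -
    have "poly (r + [:c:]) = (\<lambda>x. poly r x + c)" by auto
    moreover have "integral {0..1} (\<lambda>x. poly r x + c) = integral {0..1} (poly r) + integral {0..1} (\<lambda>x::real. c)"
      by (intro integral_add int integrable_const_ivl)
    ultimately show ?thesis by simp
  qed
  obtain q where q: "pderiv q = p"
    using poly_antiderivative_exists by blast
  show ?thesis
  proof (rule ex1I [of _ "q + [:- integral {0..1} (poly q):]"])
    show "pderiv (q + [:- integral {0..1} (poly q):]) = p \<and>
            integral {0..1} (poly (q + [:- integral {0..1} (poly q):])) = 0"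
      using q shift by (simp add: pderiv_add pderiv_pCons)
  next
    fix r assume r: "pderiv r = p \<and> integral {0..1} (poly r) = 0"
    then have "pderiv (r - q) = 0"
      using q by (simp add: pderiv_diff)
    then obtain c where "r - q = [:c:]"
      using pderiv_iszero by blast
    then have "r = q + [:c:]"
      by (simp add: algebra_simps)
    with r shift [of q c] show "r = q + [:- integral {0..1} (poly q):]"
      by (simp add: eq_neg_iff_add_eq_0 add.commute)
  qed
qed

lemma bernoulli_poly_Suc:
  "pderiv (bernoulli_poly (Suc n)) = smult (real (Suc n)) (bernoulli_poly n)"
  "integral {0..1} (poly (bernoulli_poly (Suc n))) = 0"
  using theI' [OF bernoulli_poly_step_unique [of "smult (real (Suc n)) (bernoulli_poly n)"]]
  by simp_all

definition scaled_bernoulli_poly :: "nat \<Rightarrow> real poly" where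
  "scaled_bernoulli_poly n = smult (1 / fact n) (bernoulli_poly n)"


section \<open>Total variation\<close>

text \<open>
  Each member of a division is an interval \<open>{u..v}\<close>, with \<open>u = Inf K\<close> and \<open>v = Sup K\<close>.
  The real-valued supremum is meaningful only for functions of bounded variation.
\<close>

definition total_variation :: "(real \<Rightarrow> real) \<Rightarrow> real \<Rightarrow> real \<Rightarrow> real" where
  "total_variation g a b =
     (SUP d \<in> {d. d division_of {a..b}}. \<Sum>K\<in>d. \<bar>g (Sup K) - g (Inf K)\<bar>)"

lemma poly_lipschitz_interval:
  fixes p :: "real poly"
  obtains M where "0 \<le> M" "\<And>x. x \<in> {a..b} \<Longrightarrow> \<bar>poly (pderiv p) x\<bar> \<le> M"
    "\<And>x y. x \<in> {a..b} \<Longrightarrow> y \<in> {a..b} \<Longrightarrow> \<bar>poly p x - poly p y\<bar> \<le> M * \<bar>x - y\<bar>"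
proof -
  have "bounded (poly (pderiv p) ` {a..b})"
    by (intro compact_imp_bounded compact_continuous_image continuous_intros) simp
  then obtain M where M: "0 < M" "\<And>x. x \<in> {a..b} \<Longrightarrow> \<bar>poly (pderiv p) x\<bar> \<le> M"
    unfolding bounded_pos by auto
  show ?thesis
  proof
    show "0 \<le> M" using M by simp
    show "\<bar>poly (pderiv p) x\<bar> \<le> M" if "x \<in> {a..b}" for x using M that by blast
    show "\<bar>poly p x - poly p y\<bar> \<le> M * \<bar>x - y\<bar>" if "x \<in> {a..b}" "y \<in> {a..b}" for x y
      using field_differentiable_bound [of "{a..b}" "poly p" "poly (pderiv p)" M x y] M that
      by (auto intro: DERIV_subset [OF poly_DERIV])
  qed
qed

lemma bdd_above_total_variation_poly:
  fixes p :: "real poly"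
  shows "bdd_above ((\<lambda>d. \<Sum>K\<in>d. \<bar>poly p (Sup K) - poly p (Inf K)\<bar>) ` {d. d division_of {a..b}})"
proof -
  obtain M where M: "0 \<le> M"
    "\<And>x y. x \<in> {a..b} \<Longrightarrow> y \<in> {a..b} \<Longrightarrow> \<bar>poly p x - poly p y\<bar> \<le> M * \<bar>x - y\<bar>"
    using poly_lipschitz_interval [where p = p and a = a and b = b] by metis
  have "(\<Sum>K\<in>d. \<bar>poly p (Sup K) - poly p (Inf K)\<bar>) \<le> M * measure lborel {a..b}"
    if d: "d division_of {a..b}" for d
  proof -
    have "\<bar>poly p (Sup K) - poly p (Inf K)\<bar> \<le> M * measure lborel K" if K: "K \<in> d" for K
    proof -
      obtain u v where uv: "K = {u..v}" "u \<le> v"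
        using division_ofD(3,4) [OF d K] by force
      then have "u \<in> {a..b}" "v \<in> {a..b}"
        using division_ofD(2) [OF d K] by auto
      with M(2) [of v u] uv show ?thesis by simp
    qed
    then have "(\<Sum>K\<in>d. \<bar>poly p (Sup K) - poly p (Inf K)\<bar>) \<le> (\<Sum>K\<in>d. M * measure lborel K)"
      by (rule sum_mono)
    also have "\<dots> = M * measure lborel {a..b}"
      using additive_content_division [of d a b] d by (simp add: sum_distrib_left [symmetric])
    finally show ?thesis .
  qed
  then show ?thesis
    by (intro bdd_aboveI2 [of _ _ "M * measure lborel {a..b}"]) auto
qed


section \<open>Riemann--Stieltjes integral\<close>

text \<open>
  The mesh condition appears as a gauge of constant radius: every interval of the division lies in
  the ball of radius \<open>\<delta>\<close> about its tag.
\<close>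

definition has_RS_integral ::
    "(real \<Rightarrow> real) \<Rightarrow> (real \<Rightarrow> real) \<Rightarrow> real \<Rightarrow> real \<Rightarrow> real \<Rightarrow> bool" where
  "has_RS_integral G w a b I \<longleftrightarrow>
     (\<forall>\<epsilon>>0. \<exists>\<delta>>0. \<forall>D. D tagged_division_of {a..b} \<and> (\<lambda>x. ball x \<delta>) fine D \<longrightarrow>
        \<bar>(\<Sum>(x, K)\<in>D. G x * (w (Sup K) - w (Inf K))) - I\<bar> < \<epsilon>)"

definition RS_integral ::
    "(real \<Rightarrow> real) \<Rightarrow> (real \<Rightarrow> real) \<Rightarrow> real \<Rightarrow> real \<Rightarrow> real" where
  "RS_integral G w a b = (THE I. has_RS_integral G w a b I)"

lemma has_RS_integral_unique:
  assumes "has_RS_integral G w a b I" "has_RS_integral G w a b J"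
  shows "I = J"
proof (rule ccontr)
  assume "I \<noteq> J"
  then have e: "\<bar>I - J\<bar> / 2 > 0" by simp
  let ?S = "\<lambda>D. \<Sum>(x, K)\<in>D. G x * (w (Sup K) - w (Inf K))"
  obtain d1 where d1: "d1 > 0" "\<And>D. D tagged_division_of {a..b} \<Longrightarrow> (\<lambda>x. ball x d1) fine D \<Longrightarrow>
      \<bar>?S D - I\<bar> < \<bar>I - J\<bar> / 2"
    using assms(1) e unfolding has_RS_integral_def by meson
  obtain d2 where d2: "d2 > 0" "\<And>D. D tagged_division_of {a..b} \<Longrightarrow> (\<lambda>x. ball x d2) fine D \<Longrightarrow>
      \<bar>?S D - J\<bar> < \<bar>I - J\<bar> / 2"
    using assms(2) e unfolding has_RS_integral_def by meson
  have "gauge (\<lambda>x::real. ball x (min d1 d2))"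
    using d1 d2 by (simp add: gauge_def)
  then obtain D where D: "D tagged_division_of {a..b}" "(\<lambda>x. ball x (min d1 d2)) fine D"
    using fine_division_exists_real by blast
  then have "(\<lambda>x. ball x d1) fine D" "(\<lambda>x. ball x d2) fine D"
    by (fastforce simp: fine_def)+
  then have "\<bar>?S D - I\<bar> < \<bar>I - J\<bar> / 2" "\<bar>?S D - J\<bar> < \<bar>I - J\<bar> / 2"
    using d1 d2 D by blast+
  then show False by (simp add: abs_if split: if_splits)
qed

lemma RS_integral_eqI: "has_RS_integral G w a b I \<Longrightarrow> RS_integral G w a b = I"
  unfolding RS_integral_def using has_RS_integral_unique by blast

lemma has_RS_integral_poly:
  fixes p :: "real poly"
  assumes G: "continuous_on {a..b} G"
  shows "has_RS_integral G (poly p) a b (integral {a..b} (\<lambda>x. G x * poly (pderiv p) x))"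
  unfolding has_RS_integral_def
proof (intro allI impI)
  fix e :: real assume e: "0 < e"
  obtain M where M: "0 \<le> M" "\<And>x. x \<in> {a..b} \<Longrightarrow> \<bar>poly (pderiv p) x\<bar> \<le> M"
    using poly_lipschitz_interval [where p = p and a = a and b = b] by metis
  define C where "C = M * measure lborel {a..b} + 1"
  have C: "C > 0" using M by (simp add: C_def add_nonneg_pos)
  have "uniformly_continuous_on {a..b} G"
    using G by (simp add: compact_uniformly_continuous)
  then obtain d where d: "d > 0"
    "\<And>x y. x \<in> {a..b} \<Longrightarrow> y \<in> {a..b} \<Longrightarrow> dist x y < d \<Longrightarrow> dist (G x) (G y) < e / C"
    unfolding uniformly_continuous_on_def using e C
    by (metis (no_types, lifting) divide_pos_pos dist_commute)
  let ?h = "\<lambda>x. G x * poly (pderiv p) x"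
  have hcont: "continuous_on {a..b} ?h"
    by (intro continuous_intros G)
  have "\<bar>(\<Sum>(x, K)\<in>D. G x * (poly p (Sup K) - poly p (Inf K))) - integral {a..b} ?h\<bar> < e"
    if D: "D tagged_division_of {a..b}" and fine: "(\<lambda>x. ball x d) fine D" for D
  proof -
    have bound: "\<bar>G x * (poly p (Sup K) - poly p (Inf K)) - integral K ?h\<bar> \<le> (e / C * M) * measure lborel K"
      if K: "(x, K) \<in> D" for x K
    proof -
      have xK: "x \<in> K" and Ksub: "K \<subseteq> {a..b}"
        using tagged_division_ofD(2,3) [OF D K] by auto
      obtain u v where uv: "K = {u..v}" "u \<le> v"
        using tagged_division_ofD(2,4) [OF D K] by force
      have "(poly (pderiv p) has_integral (poly p v - poly p u)) {u..v}"
        using uv(2) by (intro fundamental_theorem_of_calculus)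
          (auto simp: has_real_derivative_iff_has_vector_derivative [symmetric]
            intro: DERIV_subset [OF poly_DERIV])
      then have 1: "((\<lambda>t. G x * poly (pderiv p) t) has_integral G x * (poly p v - poly p u)) {u..v}"
        by (rule has_integral_mult_right)
      have "?h integrable_on {u..v}"
        using hcont Ksub uv by (intro integrable_continuous_interval) (metis continuous_on_subset)
      then have 2: "(?h has_integral integral K ?h) {u..v}"
        using uv by (simp add: integrable_integral)
      have 3: "((\<lambda>t. G x * poly (pderiv p) t - ?h t) has_integral
          G x * (poly p v - poly p u) - integral K ?h) (cbox u v)"
        using has_integral_diff [OF 1 2] by simp
      have "norm (G x * poly (pderiv p) t - ?h t) \<le> e / C * M" if t: "t \<in> cbox u v" for t
      proof -
        have "t \<in> K" using t uv by simp
        then have "dist x t < d"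
          using fineD [OF fine K] by auto
        then have "\<bar>G x - G t\<bar> \<le> e / C"
          using d(2) [of x t] subsetD [OF Ksub xK] subsetD [OF Ksub \<open>t \<in> K\<close>]
          by (simp add: dist_real_def)
        moreover have "\<bar>poly (pderiv p) t\<bar> \<le> M"
          using M(2) \<open>t \<in> K\<close> Ksub by blast
        ultimately have "\<bar>G x - G t\<bar> * \<bar>poly (pderiv p) t\<bar> \<le> e / C * M"
          using e C by (intro mult_mono) auto
        then show ?thesis
          by (simp add: abs_mult [symmetric] algebra_simps)
      qed
      then have "norm (G x * (poly p v - poly p u) - integral K ?h) \<le> e / C * M * measure lborel (cbox u v)"
        using e C M(1) by (intro has_integral_bound [OF _ 3]) auto
      then show ?thesis using uv by simp
    qed
    have "integral {a..b} ?h = (\<Sum>(x, K)\<in>D. integral K ?h)"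
      using integral_combine_tagged_division_topdown [of ?h a b D] D
        integrable_continuous_interval [OF hcont] by simp
    then have "\<bar>(\<Sum>(x, K)\<in>D. G x * (poly p (Sup K) - poly p (Inf K))) - integral {a..b} ?h\<bar> =
        \<bar>\<Sum>(x, K)\<in>D. G x * (poly p (Sup K) - poly p (Inf K)) - integral K ?h\<bar>"
      by (simp add: sum_subtractf [symmetric] case_prod_unfold)
    also have "\<dots> \<le> (\<Sum>(x, K)\<in>D. \<bar>G x * (poly p (Sup K) - poly p (Inf K)) - integral K ?h\<bar>)"
      by (rule order_trans [OF sum_abs]) (simp add: case_prod_unfold)
    also have "\<dots> \<le> (\<Sum>(x, K)\<in>D. (e / C * M) * measure lborel K)"
      using bound by (intro sum_mono) auto
    also have "\<dots> = (e / C * M) * measure lborel {a..b}"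
      using additive_content_tagged_division [of D a b] D
      unfolding case_prod_unfold sum_distrib_left [symmetric] box_real by metis
    also have "\<dots> = e / C * (C - 1)"
      by (simp add: C_def)
    also have "\<dots> < e"
      using e C by (simp add: field_simps)
    finally show ?thesis .
  qed
  then show "\<exists>\<delta>>0. \<forall>D. D tagged_division_of {a..b} \<and> (\<lambda>x. ball x \<delta>) fine D \<longrightarrow>
      \<bar>(\<Sum>(x, K)\<in>D. G x * (poly p (Sup K) - poly p (Inf K))) - integral {a..b} ?h\<bar> < e"
    using d(1) by blast
qed


section \<open>Distributional Denjoy integral and Alexiewicz norm\<close>

text \<open>
  A distribution that is the derivative of a continuous function is represented by such a primitive
  \<open>G\<close>, which is unique up to an additive constant.
\<close>

definition denjoy_integral_mult ::
    "(real \<Rightarrow> real) \<Rightarrow> (real \<Rightarrow> real) \<Rightarrow> real \<Rightarrow> real \<Rightarrow> real" where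
  "denjoy_integral_mult G w \<alpha> \<beta> = G \<beta> * w \<beta> - G \<alpha> * w \<alpha> - RS_integral G w \<alpha> \<beta>"

definition alexiewicz_norm :: "(real \<Rightarrow> real) \<Rightarrow> real \<Rightarrow> real \<Rightarrow> real" where
  "alexiewicz_norm G a b = (SUP (x, y) \<in> {a..b} \<times> {a..b}. \<bar>G x - G y\<bar>)"

lemma alexiewicz_norm_attained:
  assumes "a \<le> b" and G: "continuous_on {a..b} G"
  shows "\<exists>x\<in>{a..b}. \<exists>y\<in>{a..b}. alexiewicz_norm G a b = \<bar>G x - G y\<bar> \<and>
           (\<forall>x'\<in>{a..b}. \<forall>y'\<in>{a..b}. \<bar>G x' - G y'\<bar> \<le> \<bar>G x - G y\<bar>)"
proof -
  let ?S = "{a..b} \<times> {a..b}" and ?g = "\<lambda>z. \<bar>G (fst z) - G (snd z)\<bar>"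
  have "continuous_on ?S ?g"
    by (intro continuous_intros continuous_on_compose2 [OF G]) auto
  moreover have "compact ?S" "?S \<noteq> {}"
    using assms by (auto intro: compact_Times)
  ultimately obtain z where z: "z \<in> ?S" "\<forall>z'\<in>?S. ?g z' \<le> ?g z"
    using continuous_attains_sup [of ?S ?g] by blast
  have "(SUP z\<in>?S. ?g z) = ?g z"
    using z by (intro cSup_eq_maximum) auto
  then show ?thesis
    using z unfolding alexiewicz_norm_def
    by (intro bexI [of _ "fst z"] bexI [of _ "snd z"]) (auto simp: case_prod_unfold)
qed


section \<open>Iterated derivatives on a set and the error term\<close>

text \<open>Derivatives are taken within \<open>S\<close>, hence one-sided at the endpoints of an interval.\<close>

primrec nth_deriv_on :: "real set \<Rightarrow> nat \<Rightarrow> (real \<Rightarrow> real) \<Rightarrow> real \<Rightarrow> real" where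
  "nth_deriv_on S 0 f = f"
| "nth_deriv_on S (Suc k) f = (\<lambda>x. vector_derivative (nth_deriv_on S k f) (at x within S))"

definition times_differentiable_on :: "nat \<Rightarrow> (real \<Rightarrow> real) \<Rightarrow> real set \<Rightarrow> bool" where
  "times_differentiable_on m f S \<longleftrightarrow> (\<forall>k<m. nth_deriv_on S k f differentiable_on S)"

text \<open>
  \<open>f\<close> is a function on \<open>{a..b}\<close>, and \<open>{\<alpha>..\<beta>} \<subseteq> {a..b}\<close>; the distribution
  \<open>x \<mapsto> f\<^sup>(\<^sup>n\<^sup>)(\<alpha> + (\<beta> - \<alpha>) x)\<close> on \<open>{0..1}\<close> enters through its primitive.
\<close>

definition error_term ::
    "real \<Rightarrow> real \<Rightarrow> nat \<Rightarrow> real poly \<Rightarrow> (real \<Rightarrow> real) \<Rightarrow> real \<Rightarrow> real \<Rightarrow> real" where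
  "error_term a b n p f \<alpha> \<beta> =
     (- 1) ^ n * (\<beta> - \<alpha>) ^ (n + 1) *
       denjoy_integral_mult
         (\<lambda>x. nth_deriv_on {a..b} (n - 1) f (\<alpha> + (\<beta> - \<alpha>) * x) / (\<beta> - \<alpha>)) (poly p) 0 1"

lemma error_term_explicit:
  fixes a b \<alpha> \<beta> :: real and f :: "real \<Rightarrow> real" and n :: nat and p :: "real poly"
  defines "F \<equiv> nth_deriv_on {a..b} (n - 1) f"
  assumes F: "continuous_on {a..b} F" and sub: "a \<le> \<alpha>" "\<alpha> < \<beta>" "\<beta> \<le> b"
  shows "error_term a b n p f \<alpha> \<beta> =
    (- 1) ^ n * (\<beta> - \<alpha>) ^ n *
      (poly p 1 * F \<beta> - poly p 0 * F \<alpha> -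
         integral {0..1} (\<lambda>x. F (\<alpha> + (\<beta> - \<alpha>) * x) * poly (pderiv p) x))"
proof -
  let ?G = "\<lambda>x. F (\<alpha> + (\<beta> - \<alpha>) * x) / (\<beta> - \<alpha>)"
  have img: "\<alpha> + (\<beta> - \<alpha>) * x \<in> {a..b}" if "x \<in> {0..1}" for x
  proof -
    have "0 \<le> (\<beta> - \<alpha>) * x" "(\<beta> - \<alpha>) * x \<le> \<beta> - \<alpha>"
      using that sub by (auto intro: mult_left_le)
    then show ?thesis using sub unfolding atLeastAtMost_iff by linarith
  qed
  have "continuous_on {0..1} ?G"
    using img sub by (intro continuous_intros continuous_on_compose2 [OF F]) auto
  then have "RS_integral ?G (poly p) 0 1 = integral {0..1} (\<lambda>x. ?G x * poly (pderiv p) x)"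
    by (intro RS_integral_eqI has_RS_integral_poly)
  also have "\<dots> = integral {0..1} (\<lambda>x. F (\<alpha> + (\<beta> - \<alpha>) * x) * poly (pderiv p) x) / (\<beta> - \<alpha>)"
    by (simp add: divide_inverse mult_ac flip: integral_mult_right)
  finally have RS: "RS_integral ?G (poly p) 0 1 =
    integral {0..1} (\<lambda>x. F (\<alpha> + (\<beta> - \<alpha>) * x) * poly (pderiv p) x) / (\<beta> - \<alpha>)" .
  have alg: "s * r ^ (n + 1) * (A / r * u - B / r * v - C / r) = s * r ^ n * (u * A - v * B - C)"
    if "r \<noteq> 0" for s r A B C u v :: real
    using that by (simp add: field_simps)
  show ?thesis
    using sub alg [of "\<beta> - \<alpha>" "(- 1) ^ n"]
    unfolding error_term_def denjoy_integral_mult_def F_def [symmetric] RS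
    by (simp del: power_Suc)
qed

definition composite_error_term ::
    "real \<Rightarrow> real \<Rightarrow> nat \<Rightarrow> nat \<Rightarrow> real poly \<Rightarrow> (real \<Rightarrow> real) \<Rightarrow> real" where
  "composite_error_term a b N n p f =
     (let h = (b - a) / real N in
        \<Sum>k<N. error_term a b n p f (a + real k * h) (a + real (k + 1) * h))"

end

(* If q vanishes at r in [0,1] and g is continuous on [0,1], then integrating q' over [r,1] and over
   [0,r] separately gives
     q(1) g(1) - q(0) g(0) - int_0^1 g q'
       = int_0^r (g(0) - g) q' + int_r^1 (g(1) - g) q',
   which is at most (sup |g(x) - g(y)|) int_0^1 |q'|, and int_0^1 |q'| is at most the variation of q.
   Each of the N subintervals thus contributes at most h^n times the Alexiewicz norm times the
   variation. *)
theory Submission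
  imports Defs
begin

text \<open>The integral is a limit of Riemann-Stieltjes sums of \<open>G\<close> against
  \<open>p\<close>. Since \<bar>G\<bar> \<le> 1 at the tags, each such sum is at most the variation
  sum of its division.\<close>

lemma integral_mult_pderiv_le_total_variation:
  fixes p :: "real poly"
  assumes G: "continuous_on {a..b} G" and bound: "\<And>x. x \<in> {a..b} \<Longrightarrow> \<bar>G x\<bar> \<le> 1"
  shows "integral {a..b} (\<lambda>x. G x * poly (pderiv p) x) \<le> total_variation (poly p) a b"
proof (rule field_le_epsilon)
  fix e :: real assume "e > 0"
  let ?I = "integral {a..b} (\<lambda>x. G x * poly (pderiv p) x)"
  let ?S = "\<lambda>D. \<Sum>(x, K)\<in>D. G x * (poly p (Sup K) - poly p (Inf K))"
  obtain \<delta> where "\<delta> > 0" and \<delta>: "\<And>D. D tagged_division_of {a..b} \<Longrightarrow> (\<lambda>x. ball x \<delta>) fine D \<Longrightarrow>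
      \<bar>?S D - ?I\<bar> < e"
    using has_RS_integral_poly [OF G, of p] \<open>e > 0\<close> unfolding has_RS_integral_def by meson
  have "gauge (\<lambda>x::real. ball x \<delta>)"
    using \<open>\<delta> > 0\<close> by (simp add: gauge_def)
  then obtain D where D: "D tagged_division_of {a..b}" "(\<lambda>x. ball x \<delta>) fine D"
    using fine_division_exists_real by blast
  \<comment> \<open>On the empty set, \<open>Sup\<close> and \<open>Inf\<close> are unspecified reals, hence the case distinction.\<close>
  define v where "v K = (if K = {} then 0 else \<bar>poly p (Sup K) - poly p (Inf K)\<bar>)" for K
  have "?S D \<le> (\<Sum>(x, K)\<in>D. v K)"
  proof (rule sum_mono, clarify)
    fix x K assume xK: "(x, K) \<in> D"
    then have "x \<in> K" "x \<in> {a..b}"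
      using tagged_division_ofD(2,3) [OF D(1) xK] by auto
    then have "\<bar>G x\<bar> * \<bar>poly p (Sup K) - poly p (Inf K)\<bar> \<le> 1 * \<bar>poly p (Sup K) - poly p (Inf K)\<bar>"
      by (intro mult_right_mono bound) auto
    then show "G x * (poly p (Sup K) - poly p (Inf K)) \<le> v K"
      using \<open>x \<in> K\<close> by (auto simp: v_def simp flip: abs_mult)
  qed
  \<comment> \<open>Dropping the tags can merge terms only when one interval carries several tags;
    such an interval is degenerate, and \<open>v\<close> vanishes there.\<close>
  also have "\<dots> = (\<Sum>K\<in>snd ` D. v K)"
  proof (rule sum.over_tagged_division_lemma [OF D(1)])
    fix s t :: real assume "box s t = {}"
    then show "v (cbox s t) = 0"
      by (cases "s = t") (auto simp: v_def)
  qed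
  also have "\<dots> \<le> (\<Sum>K\<in>snd ` D. \<bar>poly p (Sup K) - poly p (Inf K)\<bar>)"
    by (rule sum_mono) (simp add: v_def)
  also have "\<dots> \<le> total_variation (poly p) a b"
    unfolding total_variation_def
    \<comment> \<open>The supremum of reals dominates its members only if the variation sums are
      bounded, which holds because \<open>p\<close> is Lipschitz on the interval.\<close>
    by (rule cSUP_upper [OF _ bdd_above_total_variation_poly])
      (simp add: division_of_tagged_division [OF D(1)])
  finally show "?I \<le> total_variation (poly p) a b + e"
    using \<delta> [OF D] by linarith
qed

text \<open>The sign of p' would be the ideal weight in the preceding lemma, but it may be
  discontinuous. The weight t / (\<bar>t\<bar> + \<eta>) at t = p'(x) is continuous and loses at
  most \<eta> pointwise.\<close>

lemma integral_abs_pderiv_le_total_variation: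
  fixes p :: "real poly"
  assumes "a \<le> b"
  shows "integral {a..b} (\<lambda>x. \<bar>poly (pderiv p) x\<bar>) \<le> total_variation (poly p) a b"
proof (rule field_le_epsilon)
  fix e :: real assume "e > 0"
  \<comment> \<open>The total loss (b - a) \<eta> stays below \<open>e\<close>; the added 1 keeps
    the denominator positive when a = b.\<close>
  define \<eta> where "\<eta> = e / (b - a + 1)"
  have "\<eta> > 0" and \<eta>: "(b - a) * \<eta> \<le> e"
    using \<open>e > 0\<close> assms by (auto simp: \<eta>_def field_simps)
  \<comment> \<open>A continuous substitute for the sign of the derivative.\<close>
  define G where "G = (\<lambda>x. poly (pderiv p) x / (\<bar>poly (pderiv p) x\<bar> + \<eta>))"
  have pos: "\<bar>poly (pderiv p) x\<bar> + \<eta> > 0" for x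
    using \<open>\<eta> > 0\<close> by (simp add: add_nonneg_pos)
  have G: "continuous_on {a..b} G"
    unfolding G_def using pos by (intro continuous_intros) (auto simp: less_imp_neq [symmetric])
  have "\<bar>poly (pderiv p) x\<bar> \<le> G x * poly (pderiv p) x + \<eta>" for x
  proof -
    \<comment> \<open>The left side is the difference of squares p'(x)^2 - \<eta>^2; division by the
      positive second factor gives the claim.\<close>
    have "(\<bar>poly (pderiv p) x\<bar> - \<eta>) * (\<bar>poly (pderiv p) x\<bar> + \<eta>) \<le> poly (pderiv p) x * poly (pderiv p) x"
      by (simp add: algebra_simps)
    then show ?thesis
      using pos [of x] by (simp add: G_def pos_le_divide_eq flip: diff_le_eq)
  qed
  then have "integral {a..b} (\<lambda>x. \<bar>poly (pderiv p) x\<bar>) \<le>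
      integral {a..b} (\<lambda>x. G x * poly (pderiv p) x + \<eta>)"
    by (intro integral_le integrable_continuous_interval continuous_intros G)
  also have "\<dots> = integral {a..b} (\<lambda>x. G x * poly (pderiv p) x) + (b - a) * \<eta>"
    using assms
    by (subst integral_add) (auto intro!: integrable_continuous_interval continuous_intros G)
  also have "integral {a..b} (\<lambda>x. G x * poly (pderiv p) x) \<le> total_variation (poly p) a b"
    using \<open>\<eta> > 0\<close> pos by (intro integral_mult_pderiv_le_total_variation G) (simp add: G_def)
  finally show "integral {a..b} (\<lambda>x. \<bar>poly (pderiv p) x\<bar>) \<le> total_variation (poly p) a b + e"
    using \<eta> by linarith
qed

lemma abs_integral_diff_mult_pderiv_le:
  fixes p :: "real poly"
  assumes g: "continuous_on {a..b} g" and "\<And>x. x \<in> {a..b} \<Longrightarrow> \<bar>y - g x\<bar> \<le> A"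
  shows "\<bar>integral {a..b} (\<lambda>x. (y - g x) * poly (pderiv p) x)\<bar> \<le>
           A * integral {a..b} (\<lambda>x. \<bar>poly (pderiv p) x\<bar>)"
proof -
  have "\<bar>integral {a..b} (\<lambda>x. (y - g x) * poly (pderiv p) x)\<bar> \<le>
          integral {a..b} (\<lambda>x. A * \<bar>poly (pderiv p) x\<bar>)"
    unfolding real_norm_def [symmetric]
    by (rule integral_norm_bound_integral)
      (auto simp: abs_mult intro!: integrable_continuous_interval continuous_intros g mult_right_mono assms(2))
  then show ?thesis by simp
qed

text \<open>By the fundamental theorem of calculus, the constant \<open>y\<close> contributes only a
  boundary term. Taking for \<open>y\<close> an endpoint value of \<open>g\<close> produces the
  boundary terms of the error.\<close>

lemma integral_diff_mult_pderiv:
  fixes p :: "real poly"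
  assumes "a \<le> b" and g: "continuous_on {a..b} g"
  shows "integral {a..b} (\<lambda>x. (y - g x) * poly (pderiv p) x) =
           y * (poly p b - poly p a) - integral {a..b} (\<lambda>x. g x * poly (pderiv p) x)"
proof -
  have "(poly (pderiv p) has_integral (poly p b - poly p a)) {a..b}"
    using assms(1) by (intro fundamental_theorem_of_calculus)
      (auto simp: has_real_derivative_iff_has_vector_derivative [symmetric]
        intro: DERIV_subset [OF poly_DERIV])
  moreover have "(\<lambda>x. g x * poly (pderiv p) x) integrable_on {a..b}"
    by (intro integrable_continuous_interval continuous_intros g)
  ultimately have "((\<lambda>x. y * poly (pderiv p) x - g x * poly (pderiv p) x) has_integral
      y * (poly p b - poly p a) - integral {a..b} (\<lambda>x. g x * poly (pderiv p) x)) {a..b}"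
    by (intro has_integral_diff has_integral_mult_right integrable_integral)
  then show ?thesis
    by (simp add: left_diff_distrib integral_unique)
qed

lemma abs_boundary_minus_integral_le:
  fixes q :: "real poly"
  assumes r: "r \<in> {a..b}" "poly q r = 0" and g: "continuous_on {a..b} g"
    and osc: "\<And>x y. x \<in> {a..b} \<Longrightarrow> y \<in> {a..b} \<Longrightarrow> \<bar>g x - g y\<bar> \<le> A"
  shows "\<bar>poly q b * g b - poly q a * g a - integral {a..b} (\<lambda>x. g x * poly (pderiv q) x)\<bar> \<le>
           A * integral {a..b} (\<lambda>x. \<bar>poly (pderiv q) x\<bar>)"
proof -
  have sub: "{a..r} \<subseteq> {a..b}" "{r..b} \<subseteq> {a..b}" and le: "a \<le> r" "r \<le> b"
    using r by auto
  note cont = continuous_on_subset [OF g sub(1)] continuous_on_subset [OF g sub(2)]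
  let ?J1 = "integral {a..r} (\<lambda>x. (g a - g x) * poly (pderiv q) x)"
  let ?J2 = "integral {r..b} (\<lambda>x. (g b - g x) * poly (pderiv q) x)"
  have split_g: "integral {a..b} (\<lambda>x. g x * poly (pderiv q) x) =
      integral {a..r} (\<lambda>x. g x * poly (pderiv q) x) + integral {r..b} (\<lambda>x. g x * poly (pderiv q) x)"
    by (intro Henstock_Kurzweil_Integration.integral_combine [symmetric] le
        integrable_continuous_interval continuous_intros g)
  have split_abs: "integral {a..b} (\<lambda>x. \<bar>poly (pderiv q) x\<bar>) =
      integral {a..r} (\<lambda>x. \<bar>poly (pderiv q) x\<bar>) + integral {r..b} (\<lambda>x. \<bar>poly (pderiv q) x\<bar>)"
    by (intro Henstock_Kurzweil_Integration.integral_combine [symmetric] le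
        integrable_continuous_interval continuous_intros)
  \<comment> \<open>The boundary terms g(a) (q(r) - q(a)) + g(b) (q(b) - q(r)) reduce to the
    required ones because q(r) = 0.\<close>
  have "poly q b * g b - poly q a * g a - integral {a..b} (\<lambda>x. g x * poly (pderiv q) x) = ?J1 + ?J2"
    unfolding split_g
    unfolding integral_diff_mult_pderiv [OF le(1) cont(1)] integral_diff_mult_pderiv [OF le(2) cont(2)]
    by (simp add: r(2) mult.commute)
  moreover have "\<bar>?J1\<bar> \<le> A * integral {a..r} (\<lambda>x. \<bar>poly (pderiv q) x\<bar>)"
    using le by (intro abs_integral_diff_mult_pderiv_le cont osc) auto
  moreover have "\<bar>?J2\<bar> \<le> A * integral {r..b} (\<lambda>x. \<bar>poly (pderiv q) x\<bar>)"
    using le by (intro abs_integral_diff_mult_pderiv_le cont osc) auto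
  \<comment> \<open>Both pieces have the same bound \<open>A\<close>, and their integrals of
    \<bar>q'\<bar> add up to the one over the whole interval, so splitting costs no factor
    2.\<close>
  ultimately show ?thesis
    unfolding split_abs distrib_left by linarith
qed

text \<open>The constant \<open>c\<close> serves to create the root; it disappears on
  differentiation, so only the variation of \<open>p\<close> enters. Oscillation on the subinterval
  is bounded by that on all of [a,b].\<close>

lemma abs_error_term_le:
  fixes p :: "real poly" and f :: "real \<Rightarrow> real"
  defines "F \<equiv> \<lambda>a b n. nth_deriv_on {a..b} (n - 1) f"
  assumes F: "continuous_on {a..b} (F a b n)" and sub: "a \<le> \<alpha>" "\<alpha> < \<beta>" "\<beta> \<le> b"
    and r: "r \<in> {0..1}" "poly (p + [:c:]) r = 0"
  shows "\<bar>error_term a b n (p + [:c:]) f \<alpha> \<beta>\<bar> \<le>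
           (\<beta> - \<alpha>) ^ n * (alexiewicz_norm (F a b n) a b * total_variation (poly p) 0 1)"
proof -
  let ?A = "alexiewicz_norm (F a b n) a b"
  let ?g = "\<lambda>x. F a b n (\<alpha> + (\<beta> - \<alpha>) * x)"
  have "a \<le> b" using sub by linarith
  have osc: "\<bar>F a b n x - F a b n y\<bar> \<le> ?A" if "x \<in> {a..b}" "y \<in> {a..b}" for x y
    using alexiewicz_norm_attained [OF \<open>a \<le> b\<close> F] that by force
  have "0 \<le> ?A"
    using osc [of a a] \<open>a \<le> b\<close> by simp
  have img: "\<alpha> + (\<beta> - \<alpha>) * x \<in> {a..b}" if "x \<in> {0..1}" for x
  proof -
    have "0 \<le> (\<beta> - \<alpha>) * x" "(\<beta> - \<alpha>) * x \<le> \<beta> - \<alpha>"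
      using that sub by (auto intro: mult_left_le)
    then show ?thesis using sub unfolding atLeastAtMost_iff by linarith
  qed
  have g: "continuous_on {0..1} ?g"
    using img by (intro continuous_intros continuous_on_compose2 [OF F]) auto
  have "\<bar>poly (p + [:c:]) 1 * ?g 1 - poly (p + [:c:]) 0 * ?g 0 -
      integral {0..1} (\<lambda>x. ?g x * poly (pderiv (p + [:c:])) x)\<bar> \<le>
      ?A * integral {0..1} (\<lambda>x. \<bar>poly (pderiv (p + [:c:])) x\<bar>)"
    by (intro abs_boundary_minus_integral_le [OF r g] osc img)
  also have "\<dots> = ?A * integral {0..1} (\<lambda>x. \<bar>poly (pderiv p) x\<bar>)"
    by (simp add: pderiv_add pderiv_pCons)
  also have "\<dots> \<le> ?A * total_variation (poly p) 0 1"
    by (intro mult_left_mono integral_abs_pderiv_le_total_variation \<open>0 \<le> ?A\<close>) simp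
  finally have "(\<beta> - \<alpha>) ^ n * \<bar>poly (p + [:c:]) 1 * ?g 1 - poly (p + [:c:]) 0 * ?g 0 -
      integral {0..1} (\<lambda>x. ?g x * poly (pderiv (p + [:c:])) x)\<bar> \<le>
      (\<beta> - \<alpha>) ^ n * (?A * total_variation (poly p) 0 1)"
    using sub by (intro mult_left_mono) auto
  \<comment> \<open>The affine substitution sends 0 and 1 to \<alpha> and \<beta>, and the sign
    (-1)^n has absolute value 1.\<close>
  then show ?thesis
    using sub
    by (simp add: error_term_explicit [OF F [unfolded F_def] sub] F_def abs_mult power_abs)
qed

theorem mainTheorem12:
  fixes n N :: nat and a b c :: real and f :: "real \<Rightarrow> real"
  assumes "n \<ge> 1" and "N \<ge> 1" and "a < b"
    and "times_differentiable_on (n - 1) f {a..b}"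
    and "continuous_on {a..b} (nth_deriv_on {a..b} (n - 1) f)"
    and "\<exists>x\<in>{0..1}. poly (scaled_bernoulli_poly n + [:c:]) x = 0"
  shows "\<bar>composite_error_term a b N n (scaled_bernoulli_poly n + [:c:]) f\<bar>
           \<le> (b - a) ^ n / real N ^ (n - 1)
               * alexiewicz_norm (nth_deriv_on {a..b} (n - 1) f) a b
               * total_variation (poly (scaled_bernoulli_poly n)) 0 1"
proof -
  let ?p = "scaled_bernoulli_poly n"
  let ?AV = "alexiewicz_norm (nth_deriv_on {a..b} (n - 1) f) a b * total_variation (poly ?p) 0 1"
  obtain r where r: "r \<in> {0..1}" "poly (?p + [:c:]) r = 0"
    using assms(6) by blast
  define h where "h = (b - a) / real N"
  have h: "h > 0" "real N * h = b - a"
    using assms(2,3) by (auto simp: h_def)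
  let ?E = "\<lambda>k. error_term a b n (?p + [:c:]) f (a + real k * h) (a + real (k + 1) * h)"
  have "\<bar>?E k\<bar> \<le> h ^ n * ?AV" if "k < N" for k
  proof -
    \<comment> \<open>As N h = b - a, this places the right endpoint of the subinterval at or below
      \<open>b\<close>.\<close>
    have "real (k + 1) * h \<le> real N * h"
      using that h by (intro mult_right_mono) auto
    then have "\<bar>?E k\<bar> \<le> (a + real (k + 1) * h - (a + real k * h)) ^ n * ?AV"
      using h by (intro abs_error_term_le [OF assms(5) _ _ _ r]) (auto simp: distrib_right)
    then show ?thesis
      by (simp add: distrib_right)
  qed
  then have "\<bar>\<Sum>k<N. ?E k\<bar> \<le> (\<Sum>k<N. h ^ n * ?AV)"
    by (intro order_trans [OF sum_abs] sum_mono) simp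
  also have "\<dots> = real N * h ^ n * ?AV"
    by simp
  \<comment> \<open>The number of subintervals cancels one factor of N^n. This uses n \<ge> 1, as
    \<open>n - 1\<close> is truncated at 0.\<close>
  also have "real N * h ^ n = (b - a) ^ n / real N ^ (n - 1)"
    using assms(1,2) by (cases n) (auto simp: h_def power_divide)
  finally show ?thesis
    by (simp add: composite_error_term_def Let_def h_def mult.assoc)
qed

end
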